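(* Let $X$ be a complex infinite-dimensional Banach space, $m\in\mathbb{N}^+$, and let $T\in B(X)$ be an $(m,\infty)$-isometry. Then $T$ is not $N$-supercyclic for any integer $N\ge1$.
   Context: $\mathbb{N}$ denotes the natural numbers including $0$, $\mathbb{N}^+=\mathbb{N}\setminus\{0\}$; $B(X)$ is the algebra of bounded linear operators on $X$. For $m\in\mathbb{N}^+$, an operator $T\in B(X)$ is an $(m,\infty)$-isometry if for all $x\in X$ $$\max_{\substack{k=0,\dots,m\\ k\text{ even}}}\|T^kx\|=\max_{\substack{k=0,\dots,m\\ k\text{ odd}}}\|T^kx\|.$$ $T$ is $N$-supercyclic if there exists a linear subspace $E\subseteq X$ with $\dim E=N$ such that the orbit $\bigcup_{n\in\mathbb{N}}T^n(E)$ is dense in $X$. *)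

theory Defs
  imports "HOL-Analysis.Analysis"
begin

text \<open>The norm, topology and additive structure are those of the underlying real normed space;
  the scalar multiplication by complex numbers extends the real one.\<close>

class complex_normed_vector = real_normed_vector +
  fixes scaleC :: "complex \<Rightarrow> 'a \<Rightarrow> 'a"  (infixr \<open>*\<^sub>C\<close> 75)
  assumes scaleC_add_right: "a *\<^sub>C (x + y) = a *\<^sub>C x + a *\<^sub>C y"
    and scaleC_add_left: "(a + b) *\<^sub>C x = a *\<^sub>C x + b *\<^sub>C x"
    and scaleC_scaleC: "a *\<^sub>C b *\<^sub>C x = (a * b) *\<^sub>C x"
    and scaleR_scaleC: "r *\<^sub>R x = complex_of_real r *\<^sub>C x"
    and norm_scaleC: "norm (a *\<^sub>C x) = cmod a * norm x"

class complex_banach = complex_normed_vector + complete_space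

subclass (in complex_banach) banach ..

lemma scaleC_one: "1 *\<^sub>C x = (x :: 'a::complex_normed_vector)"
  using scaleR_scaleC[of 1 x] by simp

global_interpretation complex_vector:
  vector_space "scaleC :: complex \<Rightarrow> 'a \<Rightarrow> 'a::complex_normed_vector"
  by unfold_locales
    (simp_all add: scaleC_add_right scaleC_add_left scaleC_scaleC scaleC_one)

definition cfinite_dim :: "'a::complex_normed_vector set \<Rightarrow> bool" where
  "cfinite_dim E \<longleftrightarrow> (\<exists>B. finite B \<and> complex_vector.span B = E)"

definition bounded_clinear ::
    "('a::complex_normed_vector \<Rightarrow> 'b::complex_normed_vector) \<Rightarrow> bool" where
  "bounded_clinear T \<longleftrightarrow>
     Vector_Spaces.linear scaleC scaleC T \<and> (\<exists>K. \<forall>x. norm (T x) \<le> K * norm x)"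

text \<open>Meant for \<open>m \<ge> 1\<close>: for \<open>m = 0\<close> the set of odd indices is empty and its \<open>Max\<close> is
  unspecified.\<close>

definition m_infty_isometry :: "nat \<Rightarrow> ('a::real_normed_vector \<Rightarrow> 'a) \<Rightarrow> bool" where
  "m_infty_isometry m T \<longleftrightarrow>
     (\<forall>x. Max ((\<lambda>k. norm ((T ^^ k) x)) ` {k \<in> {0..m}. even k})
        = Max ((\<lambda>k. norm ((T ^^ k) x)) ` {k \<in> {0..m}. odd k}))"

text \<open>Finite-dimensionality is required explicitly, since \<open>dim\<close> is \<open>0\<close> on infinite-dimensional
  subspaces.\<close>

definition N_supercyclic :: "nat \<Rightarrow> ('a::complex_normed_vector \<Rightarrow> 'a) \<Rightarrow> bool" where
  "N_supercyclic N T \<longleftrightarrow>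
     (\<exists>E. complex_vector.subspace E \<and> cfinite_dim E \<and> complex_vector.dim E = N
        \<and> closure (\<Union>n. (T ^^ n) ` E) = UNIV)"

end

theory Submission
  imports Defs
begin

text \<open>
  For an \<open>(m, \<infinity>)\<close>-isometry the function \<open>x \<mapsto> Max {norm ((T ^^ k) x) | k < m}\<close> is \<open>T\<close>-invariant
  (\<open>orbit_max_invariant\<close>), and it is equivalent to the norm. Hence there is a constant \<open>C\<close> with
  \<open>norm x \<le> C * norm ((T ^^ n) x)\<close> and \<open>norm ((T ^^ n) x) \<le> C * norm x\<close> for all \<open>n\<close> and \<open>x\<close>. It
  remains to show that for such an operator a finite-dimensional space \<open>E\<close> whose iterated images
  \<open>(T ^^ n) ` E\<close> have dense union can exist only if the whole space is finite-dimensional.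

  Compactness of the balls of \<open>E\<close> and the lower bound give, for each vector \<open>y\<close>, one vector
  \<open>e \<in> E\<close> such that \<open>y\<close> is a limit of points of the orbit of \<open>e\<close>
  (\<open>dense_orbits_reach_every_vector\<close>). If a bounded operator \<open>A\<close> commutes with \<open>T\<close>, then
  \<open>norm (A e)\<close> and \<open>norm (A y)\<close> agree up to the factor \<open>C\<close>
  (\<open>commuting_norms_comparable\<close>). So whatever can be said of \<open>y\<close> by bounding such \<open>A y\<close> can be
  said, with another constant, of some vector of the finite-dimensional space \<open>E\<close>.

  Let \<open>\<mu>s\<close> list the eigenvalues of \<open>T\<close> that have an eigenvector in \<open>E\<close>, and let \<open>p\<close> be the polynomial
  with these roots. Then \<open>p(T) = 0\<close> (\<open>factor_prod_annihilates\<close>). Otherwise the range of \<open>p(T)\<close>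
  is a nonzero invariant subspace, and it contains approximate eigenvectors \<open>u\<close> for unimodular
  numbers (\<open>approximate_eigenvector\<close>). They are transferred to unit vectors of \<open>E\<close>, and a
  limit \<open>w \<in> E\<close> of these is an eigenvector, with eigenvalue \<open>\<mu>\<close> say. Since \<open>\<mu>\<close> is listed, \<open>u\<close> lies in
  the range of \<open>T - \<mu>\<close>, so that the sums \<open>\<Sum>k<n. \<mu>\<^sup>-\<^sup>k T\<^sup>k u\<close> telescope and stay bounded as \<open>n\<close> grows;
  this property is transferred too. But for \<open>w\<close> these sums are \<open>n w\<close>, a contradiction.

  Finally, \<open>p(T) = 0\<close> puts \<open>E\<close> inside a finite-dimensional \<open>T\<close>-invariant space, which is closed and
  contains all \<open>(T ^^ n) ` E\<close>, hence is everything.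
\<close>

section \<open>Finite-dimensional complex subspaces\<close>

lemma bounded_bilinear_scaleC:
  "bounded_bilinear (scaleC :: complex \<Rightarrow> 'a \<Rightarrow> 'a::complex_normed_vector)"
proof
  fix r :: real and a b :: complex and x y :: 'a
  show "(r *\<^sub>R a) *\<^sub>C x = r *\<^sub>R a *\<^sub>C x"
    by (simp add: scaleR_scaleC scaleC_scaleC scaleR_conv_of_real)
  show "a *\<^sub>C r *\<^sub>R x = r *\<^sub>R a *\<^sub>C x"
    by (simp add: scaleR_scaleC scaleC_scaleC mult.commute)
  show "\<exists>K. \<forall>a (x::'a). norm (a *\<^sub>C x) \<le> norm a * norm x * K"
    by (rule exI[of _ 1]) (simp add: norm_scaleC)
qed (simp_all add: scaleC_add_right scaleC_add_left)

lemmas tendsto_scaleC = bounded_bilinear.tendsto[OF bounded_bilinear_scaleC]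

lemma closed_if_compact_Int_cball:
  fixes S :: "'a::real_normed_vector set"
  assumes "\<And>r. compact (S \<inter> cball 0 r)"
  shows "closed S"
  unfolding closed_sequential_limits
proof (intro allI impI, elim conjE)
  fix x l assume x: "\<forall>n. x n \<in> S" and l: "x \<longlonglongrightarrow> l"
  obtain r where r: "\<And>n. norm (x n) \<le> r"
    using convergent_imp_bounded[OF l] by (auto simp: bounded_iff)
  have "closed (S \<inter> cball 0 r)"
    using assms compact_imp_closed by blast
  moreover have "x n \<in> S \<inter> cball 0 r" for n
    using x r by auto
  ultimately show "l \<in> S"
    using l closed_sequentially by blast
qed

text \<open>
  Induction on the spanning set: if \<open>b\<close> has distance at least \<open>d > 0\<close> from the closed space \<open>S\<close>, then
  \<open>norm (s + c b) \<ge> \<bar>c\<bar> d\<close> for \<open>s \<in> S\<close>. Thus in a bounded part of the larger span both \<open>c\<close> and \<open>s\<close> stay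
  bounded, and this part is covered by the continuous image of a compact product.
\<close>

lemma compact_span_Int_cball:
  fixes B :: "'a::complex_normed_vector set"
  assumes "finite B"
  shows "compact (complex_vector.span B \<inter> cball 0 r)"
  using assms
proof (induction B arbitrary: r rule: finite_induct)
  case empty
  have "complex_vector.span {} \<inter> cball 0 r \<subseteq> {0::'a}" by simp
  then show ?case
    by (meson finite.emptyI finite_imp_compact finite_insert finite_subset)
next
  case (insert b B)
  let ?S = "complex_vector.span B"
  show ?case
  proof (cases "b \<in> ?S")
    case True
    then show ?thesis
      using insert.IH complex_vector.span_redundant by metis
  next
    case False
    have "closed ?S"
      using insert.IH closed_if_compact_Int_cball by blast
    then have "open (- ?S)" by blast
    with False obtain d where d: "d > 0" "ball b d \<subseteq> - ?S"
      by (meson ComplI open_contains_ball)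
    have coeff: "cmod c * d \<le> norm (s + c *\<^sub>C b)" if "s \<in> ?S" for c s
    proof (cases "c = 0")
      case False
      let ?t = "- (inverse c *\<^sub>C s)"
      have "?t \<in> ?S"
        using that by (simp add: complex_vector.span_neg complex_vector.span_scale)
      then have "d \<le> dist b ?t"
        using d by force
      moreover have "s + c *\<^sub>C b = c *\<^sub>C (b - ?t)"
        using False by (simp add: scaleC_add_right scaleC_scaleC scaleC_one)
      ultimately show ?thesis
        by (simp add: norm_scaleC dist_norm mult_left_mono)
    qed simp
    define R where "R = r / d"
    let ?K = "(\<lambda>p. snd p + fst p *\<^sub>C b) ` (cball 0 R \<times> (?S \<inter> cball 0 (r + R * norm b)))"
    have "compact ?K"
    proof (rule compact_continuous_image)
      show "continuous_on (cball 0 R \<times> (?S \<inter> cball 0 (r + R * norm b)))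
              (\<lambda>p. snd p + fst p *\<^sub>C b)"
        by (intro continuous_on_add continuous_on_snd continuous_on_id
            bounded_bilinear.continuous_on[OF bounded_bilinear_scaleC]
            continuous_on_fst continuous_on_const)
      show "compact (cball (0::complex) R \<times> (?S \<inter> cball 0 (r + R * norm b)))"
        using insert.IH by (simp add: compact_Times)
    qed
    moreover have "complex_vector.span (insert b B) \<inter> cball 0 r = ?K \<inter> cball 0 r"
    proof (intro equalityI subsetI)
      fix y assume y: "y \<in> complex_vector.span (insert b B) \<inter> cball 0 r"
      then obtain c where c: "y - c *\<^sub>C b \<in> ?S"
        using complex_vector.span_breakdown_eq by blast
      have "cmod c * d \<le> r"
        using coeff[OF c, of c] y by simp
      then have cR: "cmod c \<le> R"
        using d by (simp add: R_def field_simps)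
      have "norm (y - c *\<^sub>C b) \<le> norm y + cmod c * norm b"
        by (metis norm_scaleC norm_triangle_ineq4)
      also have "\<dots> \<le> r + R * norm b"
        using cR y by (intro add_mono mult_right_mono) auto
      finally have "(c, y - c *\<^sub>C b) \<in> cball 0 R \<times> (?S \<inter> cball 0 (r + R * norm b))"
        using c cR by simp
      moreover have "y = snd (c, y - c *\<^sub>C b) + fst (c, y - c *\<^sub>C b) *\<^sub>C b" by simp
      ultimately show "y \<in> ?K \<inter> cball 0 r"
        using y by blast
    next
      fix y assume y: "y \<in> ?K \<inter> cball 0 r"
      then obtain p where "snd p \<in> ?S" "y = snd p + fst p *\<^sub>C b" by force
      then have "y - fst p *\<^sub>C b \<in> ?S" by simp
      then show "y \<in> complex_vector.span (insert b B) \<inter> cball 0 r"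
        using y complex_vector.span_breakdown_eq by blast
    qed
    ultimately show ?thesis
      by (simp add: compact_Int_closed)
  qed
qed

corollary closed_span_finite:
  fixes B :: "'a::complex_normed_vector set"
  shows "finite B \<Longrightarrow> closed (complex_vector.span B)"
  using closed_if_compact_Int_cball compact_span_Int_cball by blast

section \<open>Isometries for a maximum have two-sided bounded powers\<close>

text \<open>
  The maxima over the two parity classes are equal, so a value in one class is dominated by the
  largest value in the other.
\<close>

lemma m_infty_isometry_dominating_index:
  assumes iso: "m_infty_isometry m T" and "m \<ge> 1" and "k \<le> m"
  obtains j where "j \<le> m" "even j \<longleftrightarrow> odd k" "norm ((T ^^ k) x) \<le> norm ((T ^^ j) x)"
proof -
  let ?f = "\<lambda>k. norm ((T ^^ k) x)"
  let ?A = "\<lambda>e. {k \<in> {0..m}. even k \<longleftrightarrow> e}"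
  have ne: "?A e \<noteq> {}" for e
  proof (cases e)
    case True
    then have "0 \<in> ?A e" by simp
    then show ?thesis by blast
  next
    case False
    then have "1 \<in> ?A e" using \<open>m \<ge> 1\<close> by simp
    then show ?thesis by blast
  qed
  have "Max (?f ` ?A True) = Max (?f ` ?A False)"
    using iso by (simp add: m_infty_isometry_def)
  then have eq: "Max (?f ` ?A (even k)) = Max (?f ` ?A (odd k))"
    by (cases "even k") auto
  have "?f k \<le> Max (?f ` ?A (even k))"
    using \<open>k \<le> m\<close> by (intro Max_ge) auto
  moreover have "Max (?f ` ?A (odd k)) \<in> ?f ` ?A (odd k)"
    using ne by (intro Max_in) auto
  then obtain j where "j \<in> ?A (odd k)" "Max (?f ` ?A (odd k)) = ?f j" by blast
  ultimately show thesis
    using that[of j] eq by auto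
qed

definition orbit_max :: "nat \<Rightarrow> ('a::real_normed_vector \<Rightarrow> 'a) \<Rightarrow> 'a \<Rightarrow> real" where
  "orbit_max m T x = Max ((\<lambda>k. norm ((T ^^ k) x)) ` {..<m})"

lemma orbit_max_ge: "k < m \<Longrightarrow> norm ((T ^^ k) x) \<le> orbit_max m T x"
  unfolding orbit_max_def by (intro Max_ge) auto

lemma orbit_max_le:
  assumes "m \<ge> 1" and "\<And>k. k < m \<Longrightarrow> norm ((T ^^ k) x) \<le> c"
  shows "orbit_max m T x \<le> c"
proof -
  have "{..<m} \<noteq> {}" using assms by (auto simp: lessThan_empty_iff)
  then show ?thesis
    unfolding orbit_max_def using assms by (subst Max_le_iff) auto
qed

text \<open>
  Passing from \<open>x\<close> to \<open>T x\<close> replaces the indices \<open>0, \<dots>, m - 1\<close> by \<open>1, \<dots>, m\<close>. The norm at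
  the lost index \<open>0\<close> is dominated at an odd index, which is in the new range, and the norm at the gained
  index \<open>m\<close> at an index of the other parity, which is in the old range.
\<close>

lemma orbit_max_invariant:
  assumes iso: "m_infty_isometry m T" and m: "m \<ge> 1"
  shows "orbit_max m T (T x) = orbit_max m T x"
proof (rule antisym; rule orbit_max_le[OF m])
  have shift: "(T ^^ k) (T x) = (T ^^ Suc k) x" for k
    by (simp add: funpow_swap1)
  fix k assume "k < m"
  show "norm ((T ^^ k) (T x)) \<le> orbit_max m T x"
  proof (cases "Suc k < m")
    case True
    then show ?thesis unfolding shift by (rule orbit_max_ge)
  next
    case False
    with \<open>k < m\<close> have "Suc k = m" by simp
    then obtain j where j: "j \<le> m" "even j \<longleftrightarrow> odd m"
      "norm ((T ^^ Suc k) x) \<le> norm ((T ^^ j) x)"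
      using m_infty_isometry_dominating_index[OF iso m order_refl] by metis
    then have "j < m"
      by (metis le_neq_implies_less)
    then show ?thesis
      unfolding shift using j orbit_max_ge order_trans by blast
  qed
  have pos: "norm ((T ^^ j) x) \<le> orbit_max m T (T x)" if "j \<le> m" "j \<ge> 1" for j
    using that orbit_max_ge[of "j - 1" m T "T x"] shift[of "j - 1"] by simp
  show "norm ((T ^^ k) x) \<le> orbit_max m T (T x)"
  proof (cases "k = 0")
    case True
    then obtain j where j: "j \<le> m" "odd j" "norm ((T ^^ k) x) \<le> norm ((T ^^ j) x)"
      using m_infty_isometry_dominating_index[OF iso m, of 0] by auto
    then have "j \<ge> 1" by (cases j) auto
    then show ?thesis
      using pos[of j] j by linarith
  next
    case False
    then show ?thesis using \<open>k < m\<close> by (intro pos) auto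
  qed
qed

text \<open>
  The bounds say that \<open>T\<close> is an isometry for an equivalent norm. Stated with a constant, they allow
  the argument to be carried out in the given norm.
\<close>

locale two_sided_power_bounded =
  fixes T :: "'a::complex_normed_vector \<Rightarrow> 'a" and C :: real
  assumes lin: "Vector_Spaces.linear scaleC scaleC T"
    and C_pos: "C > 0"
    and upper: "norm ((T ^^ n) x) \<le> C * norm x"
    and lower: "norm x \<le> C * norm ((T ^^ n) x)"

lemma m_infty_isometry_two_sided_power_bounded:
  assumes T: "bounded_clinear T" and iso: "m_infty_isometry m T" and m: "m \<ge> 1"
  shows "\<exists>C. two_sided_power_bounded T C"
proof -
  obtain K where K: "\<And>x. norm (T x) \<le> K * norm x"
    using T by (auto simp: bounded_clinear_def)
  define K' where "K' = max K 1"
  have K': "norm (T x) \<le> K' * norm x" for x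
    using K[of x] mult_right_mono[of K K' "norm x"] by (simp add: K'_def)
  have K'1: "K' \<ge> 1" by (simp add: K'_def)
  define C where "C = K' ^ m"
  have pow: "norm ((T ^^ k) x) \<le> K' ^ k * norm x" for k x
  proof (induction k)
    case (Suc k)
    have "norm ((T ^^ Suc k) x) \<le> K' * norm ((T ^^ k) x)"
      using K' by simp
    also have "\<dots> \<le> K' * (K' ^ k * norm x)"
      using Suc K'1 by (intro mult_left_mono) auto
    finally show ?case by (simp add: mult.assoc)
  qed simp
  have le_C: "orbit_max m T x \<le> C * norm x" for x
  proof (rule orbit_max_le[OF m])
    fix k assume "k < m"
    then have "K' ^ k * norm x \<le> C * norm x"
      unfolding C_def using K'1 by (intro mult_right_mono power_increasing) auto
    with pow[of k x] show "norm ((T ^^ k) x) \<le> C * norm x" by linarith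
  qed
  have inv: "orbit_max m T ((T ^^ n) x) = orbit_max m T x" for n x
    by (induction n) (auto simp: orbit_max_invariant[OF iso m])
  have ge: "norm x \<le> orbit_max m T x" for x
    using orbit_max_ge[of 0 m T x] m by simp
  have "two_sided_power_bounded T C"
  proof (rule two_sided_power_bounded.intro)
    show "Vector_Spaces.linear scaleC scaleC T"
      using T by (simp add: bounded_clinear_def)
    show "C > 0" using K'1 by (simp add: C_def)
    show "norm ((T ^^ n) x) \<le> C * norm x" for n x
      using ge[of "(T ^^ n) x"] inv[of n x] le_C[of x] by linarith
    show "norm x \<le> C * norm ((T ^^ n) x)" for n x
      using ge[of x] inv[of n x] le_C[of "(T ^^ n) x"] by linarith
  qed
  then show ?thesis by blast
qed

section \<open>Approximate eigenvectors\<close>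

lemma sum_powers_roots_of_unity:
  assumes "L \<ge> 1"
  shows "(\<Sum>j<L. exp (2 * of_real pi * \<i> * of_nat j / of_nat L) ^ d)
    = (if L dvd d then of_nat L else 0)"
proof -
  let ?\<omega> = "exp (2 * of_real pi * \<i> * of_nat d / of_nat L)"
  have swap: "exp (2 * of_real pi * \<i> * of_nat j / of_nat L) ^ d = ?\<omega> ^ j" for j
    by (simp flip: exp_of_nat_mult add: mult_ac)
  show ?thesis
  proof (cases "L dvd d")
    case True
    then have "?\<omega> = 1" using complex_root_unity_eq_1 assms by blast
    with True show ?thesis unfolding swap by simp
  next
    case False
    then have "?\<omega> \<noteq> 1" using complex_root_unity_eq_1 assms by blast
    moreover have "?\<omega> ^ L = 1" using complex_root_unity assms by simp
    ultimately show ?thesis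
      using False by (simp add: swap sum_gp_strict)
  qed
qed

context two_sided_power_bounded
begin

lemma hom: "module_hom scaleC scaleC T"
  using lin by (simp add: Vector_Spaces.linear_def)

lemma hom_pow: "module_hom scaleC scaleC (T ^^ n)"
proof (induction n)
  case 0
  show ?case
    by (simp add: module_hom_def module_hom_axioms_def complex_vector.module_axioms)
next
  case (Suc n)
  then show ?case
    using module_hom_compose[OF Suc hom] by (simp only: funpow.simps)
qed

lemmas T_add = module_hom.add[OF hom]
  and T_diff = module_hom.diff[OF hom]
  and T_scale = module_hom.scale[OF hom]
  and T_zero = module_hom.zero[OF hom]
  and T_sum = module_hom.sum[OF hom]
  and pow_add = module_hom.add[OF hom_pow]
  and pow_diff = module_hom.diff[OF hom_pow]
  and pow_scale = module_hom.scale[OF hom_pow]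
  and pow_sum = module_hom.sum[OF hom_pow]

text \<open>
  The geometric sum of \<open>\<omega> T\<close>. It serves twice: with \<open>\<omega>\<close> running through roots of unity it
  produces approximate eigenvectors, and for the inverse \<open>\<omega>\<close> of an eigenvalue it is an unnormalized
  ergodic average.
\<close>

definition twisted_sum :: "complex \<Rightarrow> nat \<Rightarrow> 'a \<Rightarrow> 'a" where
  "twisted_sum \<omega> M u = (\<Sum>n<M. \<omega> ^ n *\<^sub>C (T ^^ n) u)"

lemma twisted_sum_telescope:
  "twisted_sum \<omega> M u - \<omega> *\<^sub>C T (twisted_sum \<omega> M u) = u - \<omega> ^ M *\<^sub>C (T ^^ M) u"
proof (induction M)
  case 0
  then show ?case by (simp add: twisted_sum_def T_zero scaleC_one)
next
  case (Suc M)
  let ?S = "twisted_sum \<omega> M u" and ?a = "\<omega> ^ M *\<^sub>C (T ^^ M) u"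
  have "twisted_sum \<omega> (Suc M) u = ?S + ?a"
    by (simp add: twisted_sum_def)
  moreover have "?S + ?a - \<omega> *\<^sub>C T (?S + ?a) = (?S - \<omega> *\<^sub>C T ?S) + (?a - \<omega> *\<^sub>C T ?a)"
    by (simp add: T_add scaleC_add_right)
  ultimately show ?case
    by (simp add: Suc T_scale scaleC_scaleC)
qed

lemma twisted_sum_telescope_norm:
  assumes "cmod \<omega> = 1"
  shows "norm (T (twisted_sum \<omega> M u) - inverse \<omega> *\<^sub>C twisted_sum \<omega> M u) \<le> (1 + C) * norm u"
proof -
  let ?v = "twisted_sum \<omega> M u"
  have "\<omega> \<noteq> 0" using assms by auto
  then have "?v - \<omega> *\<^sub>C T ?v = - (\<omega> *\<^sub>C (T ?v - inverse \<omega> *\<^sub>C ?v))"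
    by (simp add: complex_vector.scale_right_diff_distrib scaleC_scaleC scaleC_one)
  then have "norm (T ?v - inverse \<omega> *\<^sub>C ?v) = norm (u - \<omega> ^ M *\<^sub>C (T ^^ M) u)"
    using assms by (metis twisted_sum_telescope norm_minus_cancel norm_scaleC mult_1)
  also have "\<dots> \<le> norm u + norm (\<omega> ^ M *\<^sub>C (T ^^ M) u)"
    by (rule norm_triangle_ineq4)
  also have "\<dots> \<le> (1 + C) * norm u"
    using upper[of M u] assms by (simp add: norm_scaleC norm_power distrib_right)
  finally show ?thesis .
qed

lemma twisted_sum_in:
  assumes Y: "complex_vector.subspace Y" and inv: "T ` Y \<subseteq> Y" and "u \<in> Y"
  shows "twisted_sum \<omega> M u \<in> Y"
proof -
  have "(T ^^ n) u \<in> Y" for n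
    using inv \<open>u \<in> Y\<close> by (induction n) auto
  then show ?thesis
    unfolding twisted_sum_def
    using Y by (intro complex_vector.subspace_sum complex_vector.subspace_scale)
qed

text \<open>
  Extraction of a Fourier coefficient: the square of \<open>\<Sum>n<M. \<omega>\<^sup>n T\<^sup>n\<close> is a polynomial in \<open>\<omega>\<close> of degree
  \<open>2 M - 2\<close> whose middle coefficient is \<open>M T\<^sup>M\<^sup>-\<^sup>1\<close>. Averaging over the \<open>2 M\<close>-th roots of unity isolates
  it. The weight \<open>\<omega>\<^sup>M\<^sup>+\<^sup>1\<close> is \<open>\<omega>\<close> to the power \<open>-(M - 1)\<close> for such \<open>\<omega>\<close>.
\<close>

lemma twisted_sum_twice_average:
  assumes "M \<ge> 1"
  defines "\<omega> \<equiv> \<lambda>j::nat. exp (2 * of_real pi * \<i> * of_nat j / of_nat (2 * M))"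
  shows "(\<Sum>j<2*M. \<omega> j ^ Suc M *\<^sub>C twisted_sum (\<omega> j) M (twisted_sum (\<omega> j) M y))
    = of_nat (2 * M * M) *\<^sub>C (T ^^ (M - 1)) y"
proof -
  let ?t = "\<lambda>j n k. \<omega> j ^ (Suc M + n + k) *\<^sub>C (T ^^ (n + k)) y"
  have expand: "\<omega> j ^ Suc M *\<^sub>C twisted_sum (\<omega> j) M (twisted_sum (\<omega> j) M y)
      = (\<Sum>n<M. \<Sum>k<M. ?t j n k)" for j
    by (simp add: twisted_sum_def pow_sum pow_scale complex_vector.scale_sum_right scaleC_scaleC
        funpow_add power_add mult_ac)
  have collapse: "(\<Sum>j<2*M. ?t j n k) = (if n + k = M - 1 then of_nat (2 * M) *\<^sub>C (T ^^ (M - 1)) y else 0)"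
    if "n < M" "k < M" for n k
  proof -
    have dvd: "2 * M dvd Suc M + n + k \<longleftrightarrow> n + k = M - 1"
    proof
      assume "2 * M dvd Suc M + n + k"
      then obtain q where q: "Suc M + n + k = 2 * M * q" by (auto elim: dvdE)
      have "q < 2"
      proof (rule ccontr)
        assume "\<not> q < 2"
        then have "2 * M * 2 \<le> 2 * M * q" by (intro mult_le_mono) auto
        with q that show False by simp
      qed
      moreover have "q \<noteq> 0" using q by (intro notI) simp
      ultimately have "q = 1" by simp
      with q show "n + k = M - 1" by simp
    next
      assume "n + k = M - 1"
      then have "Suc M + n + k = 2 * M" using assms by simp
      then show "2 * M dvd Suc M + n + k" by (simp only: dvd_refl)
    qed
    have "(\<Sum>j<2*M. ?t j n k) = (\<Sum>j<2*M. \<omega> j ^ (Suc M + n + k)) *\<^sub>C (T ^^ (n + k)) y"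
      by (simp only: complex_vector.scale_sum_left)
    then show ?thesis
      unfolding \<omega>_def
      using sum_powers_roots_of_unity[of "2 * M" "Suc M + n + k"] assms(1) dvd
      by auto
  qed
  have inner: "(\<Sum>k<M. \<Sum>j<2*M. ?t j n k) = of_nat (2 * M) *\<^sub>C (T ^^ (M - 1)) y" if "n < M" for n
  proof -
    have "(\<Sum>k<M. \<Sum>j<2*M. ?t j n k)
      = (\<Sum>k<M. if k = M - 1 - n then of_nat (2 * M) *\<^sub>C (T ^^ (M - 1)) y else 0)"
      using that by (intro sum.cong refl) (subst collapse, auto)
    also have "\<dots> = of_nat (2 * M) *\<^sub>C (T ^^ (M - 1)) y"
      using that by (subst sum.delta) auto
    finally show ?thesis .
  qed
  have "(\<Sum>j<2*M. \<Sum>n<M. \<Sum>k<M. ?t j n k) = (\<Sum>n<M. \<Sum>j<2*M. \<Sum>k<M. ?t j n k)"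
    by (rule sum.swap)
  also have "\<dots> = (\<Sum>n<M. \<Sum>k<M. \<Sum>j<2*M. ?t j n k)"
    by (intro sum.cong refl sum.swap)
  also have "\<dots> = (\<Sum>n<M. of_nat (2 * M) *\<^sub>C (T ^^ (M - 1)) y)"
    using inner by (intro sum.cong) auto
  also have "\<dots> = of_nat (2 * M * M) *\<^sub>C (T ^^ (M - 1)) y"
    by (simp add: complex_vector.sum_constant_scale scaleC_scaleC mult_ac)
  finally show ?thesis
    by (simp only: expand)
qed

text \<open>
  In place of the nonemptiness of the spectrum, a finite Fourier argument is used. If every \<open>T - \<mu>\<close> with \<open>\<bar>\<mu>\<bar> = 1\<close> were bounded below on \<open>Y\<close> by the same \<open>\<epsilon>\<close>, then telescoping
  would bound the geometric sums \<open>\<Sum>n<M. \<omega>\<^sup>n T\<^sup>n\<close> on \<open>Y\<close>, and hence also their squares, independently of \<open>M\<close> and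
  \<open>\<omega>\<close>. But the squares have the Fourier coefficient \<open>M T\<^sup>M\<^sup>-\<^sup>1\<close>, whose size on a fixed vector grows
  like \<open>M\<close>.
\<close>

proposition approximate_eigenvector:
  assumes Y: "complex_vector.subspace Y" and inv: "T ` Y \<subseteq> Y"
    and y: "y \<in> Y" "y \<noteq> 0" and "\<epsilon> > 0"
  obtains \<mu> u where "cmod \<mu> = 1" "u \<in> Y" "u \<noteq> 0" "norm (T u - \<mu> *\<^sub>C u) \<le> \<epsilon> * norm u"
proof (rule ccontr)
  note witness = that
  assume contra: "\<not> thesis"
  have bound_below: "\<epsilon> * norm u \<le> norm (T u - \<mu> *\<^sub>C u)"
    if u: "cmod \<mu> = 1" "u \<in> Y" for \<mu> u
  proof (rule ccontr)
    assume "\<not> ?thesis"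
    then have "norm (T u - \<mu> *\<^sub>C u) \<le> \<epsilon> * norm u" "u \<noteq> 0"
      using \<open>\<epsilon> > 0\<close> by auto
    with witness u contra show False by blast
  qed
  define c where "c = (1 + C) / \<epsilon>"
  have c: "c > 0" using C_pos \<open>\<epsilon> > 0\<close> by (simp add: c_def)
  have small: "norm (twisted_sum \<omega> M u) \<le> c * norm u" if "cmod \<omega> = 1" "u \<in> Y" for \<omega> M u
  proof -
    have "\<epsilon> * norm (twisted_sum \<omega> M u) \<le> (1 + C) * norm u"
      using bound_below[of "inverse \<omega>" "twisted_sum \<omega> M u"] twisted_sum_in[OF Y inv]
        twisted_sum_telescope_norm[of \<omega> M u] that
      by (simp add: norm_inverse)
    then show ?thesis
      using \<open>\<epsilon> > 0\<close> by (simp add: c_def field_simps)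
  qed
  have "real M \<le> C * c\<^sup>2" if M: "M \<ge> 1" for M
  proof -
    let ?\<omega> = "\<lambda>j::nat. exp (2 * of_real pi * \<i> * of_nat j / of_nat (2 * M))"
    let ?w = "\<lambda>j. ?\<omega> j ^ Suc M *\<^sub>C twisted_sum (?\<omega> j) M (twisted_sum (?\<omega> j) M y)"
    have unit: "cmod (?\<omega> j) = 1" for j
      by simp
    have w: "norm (?w j) \<le> c\<^sup>2 * norm y" for j
    proof -
      have "norm (?w j) = norm (twisted_sum (?\<omega> j) M (twisted_sum (?\<omega> j) M y))"
        by (simp only: norm_scaleC norm_power unit power_one mult_1)
      also have "\<dots> \<le> c * norm (twisted_sum (?\<omega> j) M y)"
        by (intro small unit twisted_sum_in[OF Y inv] y)
      also have "\<dots> \<le> c * (c * norm y)"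
        using c small[OF unit y(1)] by (intro mult_left_mono) auto
      finally show ?thesis by (simp add: power2_eq_square mult.assoc)
    qed
    have "real (2 * M * M) * norm ((T ^^ (M - 1)) y) = norm (\<Sum>j<2*M. ?w j)"
      by (subst twisted_sum_twice_average[OF M]) (simp only: norm_scaleC norm_of_nat)
    also have "\<dots> \<le> (\<Sum>j<2*M. c\<^sup>2 * norm y)"
      by (rule sum_norm_le) (rule w)
    finally have "real (2 * M) * (real M * norm ((T ^^ (M - 1)) y)) \<le> real (2 * M) * (c\<^sup>2 * norm y)"
      by (simp add: mult.assoc)
    then have "real M * norm ((T ^^ (M - 1)) y) \<le> c\<^sup>2 * norm y"
      by (rule mult_left_le_imp_le) (use M in simp)
    then have "C * (real M * norm ((T ^^ (M - 1)) y)) \<le> C * (c\<^sup>2 * norm y)"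
      using C_pos by (intro mult_left_mono) auto
    moreover have "real M * norm y \<le> real M * (C * norm ((T ^^ (M - 1)) y))"
      by (intro mult_left_mono lower) auto
    ultimately have "real M * norm y \<le> (C * c\<^sup>2) * norm y"
      by (simp add: mult_ac)
    then show ?thesis
      using y by (simp add: mult_le_cancel_right)
  qed
  moreover obtain M :: nat where M: "real M > max 1 (C * c\<^sup>2)"
    using reals_Archimedean2 by blast
  moreover have "M \<ge> 1" using M by simp
  ultimately show False by fastforce
qed

section \<open>Comparing vectors with limits of their orbits\<close>

text \<open>
  If \<open>T\<^sup>n e\<close> is close to \<open>y\<close>, then \<open>A y\<close> is close to \<open>A T\<^sup>n e = T\<^sup>n A e\<close>, whose norm is that of \<open>A e\<close> up to the
  factor \<open>C\<close>.
\<close>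

lemma commuting_norms_comparable:
  assumes A: "module_hom scaleC scaleC A" and bound: "\<And>x. norm (A x) \<le> K * norm x"
    and comm: "\<And>x. A (T x) = T (A x)"
    and y: "y \<in> closure (range (\<lambda>n. (T ^^ n) e))"
  shows "norm (A e) \<le> C * norm (A y)" and "norm (A y) \<le> C * norm (A e)"
proof -
  have comm_pow: "A ((T ^^ n) x) = (T ^^ n) (A x)" for n x
    by (induction n) (auto simp: comm)
  have approx: "\<exists>n. norm (A y - (T ^^ n) (A e)) \<le> \<delta>" if "\<delta> > 0" for \<delta>
  proof -
    define K' where "K' = max K 1"
    have "K' > 0" "K \<le> K'" by (auto simp: K'_def)
    with that y obtain n where n: "norm ((T ^^ n) e - y) < \<delta> / K'"
      unfolding closure_approachable dist_norm by (metis (no_types, lifting) divide_pos_pos imageE)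
    have "norm (A y - (T ^^ n) (A e)) = norm (A ((T ^^ n) e - y))"
      by (simp add: module_hom.diff[OF A] comm_pow norm_minus_commute)
    also have "\<dots> \<le> K' * norm ((T ^^ n) e - y)"
      using bound[of "(T ^^ n) e - y"] \<open>K \<le> K'\<close>
      by (meson mult_right_mono norm_ge_zero order_trans)
    also have "\<dots> \<le> K' * (\<delta> / K')"
      using n \<open>K' > 0\<close> by (intro mult_left_mono) auto
    finally show ?thesis using \<open>K' > 0\<close> by auto
  qed
  show "norm (A e) \<le> C * norm (A y)"
  proof (rule field_le_epsilon)
    fix \<eta> :: real assume "\<eta> > 0"
    then obtain n where n: "norm (A y - (T ^^ n) (A e)) \<le> \<eta> / C"
      using approx[of "\<eta> / C"] C_pos by auto
    have "norm (A e) \<le> C * norm ((T ^^ n) (A e))" by (rule lower)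
    also have "\<dots> \<le> C * (norm (A y) + \<eta> / C)"
      using n C_pos norm_triangle_ineq2[of "(T ^^ n) (A e)" "A y"]
      by (intro mult_left_mono) (auto simp: norm_minus_commute)
    finally show "norm (A e) \<le> C * norm (A y) + \<eta>"
      using C_pos by (simp add: distrib_left)
  qed
  show "norm (A y) \<le> C * norm (A e)"
  proof (rule field_le_epsilon)
    fix \<eta> :: real assume "\<eta> > 0"
    then obtain n where n: "norm (A y - (T ^^ n) (A e)) \<le> \<eta>"
      using approx by blast
    then show "norm (A y) \<le> C * norm (A e) + \<eta>"
      using upper[of n "A e"] norm_triangle_ineq2[of "A y" "(T ^^ n) (A e)"] by linarith
  qed
qed

text \<open>
  Density gives \<open>T\<^bsup>n(k)\<^esup> f(k) \<rightarrow> y\<close> with \<open>f(k)\<close> in the span. The lower bound keeps the \<open>f(k)\<close> bounded, so a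
  subsequence has a limit \<open>e\<close>, and the upper bound allows \<open>f(k)\<close> to be replaced by \<open>e\<close>.
\<close>

lemma dense_orbits_reach_every_vector:
  assumes "finite B" and dense: "closure (\<Union>n. (T ^^ n) ` complex_vector.span B) = UNIV"
  obtains e where "e \<in> complex_vector.span B" "y \<in> closure (range (\<lambda>n. (T ^^ n) e))"
proof -
  let ?E = "complex_vector.span B"
  have "\<exists>e n. e \<in> ?E \<and> norm ((T ^^ n) e - y) < inverse (real (Suc k))" for k
  proof -
    have "y \<in> closure (\<Union>n. (T ^^ n) ` ?E)" using dense by simp
    then have "\<exists>w \<in> (\<Union>n. (T ^^ n) ` ?E). dist w y < inverse (real (Suc k))"
      unfolding closure_approachable by simp
    then show ?thesis by (auto simp: dist_norm)
  qed
  then obtain f n where f: "\<And>k. f k \<in> ?E"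
    and n: "\<And>k. norm ((T ^^ n k) (f k) - y) < inverse (real (Suc k))"
    by metis
  have "norm (f k) \<le> C * (norm y + 1)" for k
  proof -
    have "inverse (real (Suc k)) \<le> 1" by (simp add: field_simps)
    then have "norm ((T ^^ n k) (f k)) \<le> norm y + 1"
      using n[of k] norm_triangle_ineq2[of "(T ^^ n k) (f k)" y] by linarith
    then show ?thesis
      using lower[of "f k" "n k"] C_pos by (meson less_imp_le mult_left_mono order_trans)
  qed
  then have "\<forall>k. f k \<in> ?E \<inter> cball 0 (C * (norm y + 1))" using f by simp
  moreover have "compact (?E \<inter> cball 0 (C * (norm y + 1)))"
    using compact_span_Int_cball \<open>finite B\<close> by blast
  ultimately obtain e r where e: "e \<in> ?E" and r: "strict_mono r" and lim: "(f \<circ> r) \<longlonglongrightarrow> e"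
    unfolding compact_def by blast
  have "y \<in> closure (range (\<lambda>n. (T ^^ n) e))"
    unfolding closure_approachable
  proof (intro allI impI)
    fix \<delta> :: real assume "\<delta> > 0"
    have "(\<lambda>k. C * norm (f (r k) - e) + inverse (real (Suc (r k)))) \<longlonglongrightarrow> C * 0 + 0"
      using lim LIMSEQ_subseq_LIMSEQ[OF LIMSEQ_inverse_real_of_nat r]
      by (intro tendsto_intros tendsto_norm_zero) (auto simp: o_def LIM_zero)
    then have "\<forall>\<^sub>F k in sequentially. C * norm (f (r k) - e) + inverse (real (Suc (r k))) < \<delta>"
      using order_tendstoD(2) \<open>\<delta> > 0\<close> by fastforce
    then obtain k where k: "C * norm (f (r k) - e) + inverse (real (Suc (r k))) < \<delta>"
      by (auto simp: eventually_sequentially)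
    let ?n = "n (r k)"
    have "(T ^^ ?n) e - y = ((T ^^ ?n) (f (r k)) - y) - (T ^^ ?n) (f (r k) - e)"
      by (simp add: pow_diff)
    then have "norm ((T ^^ ?n) e - y)
        \<le> norm ((T ^^ ?n) (f (r k)) - y) + norm ((T ^^ ?n) (f (r k) - e))"
      by (metis norm_triangle_ineq4)
    then have "dist ((T ^^ ?n) e) y < \<delta>"
      using k n[of "r k"] upper[of ?n "f (r k) - e"] unfolding dist_norm by linarith
    then show "\<exists>w\<in>range (\<lambda>n. (T ^^ n) e). dist w y < \<delta>" by blast
  qed
  with e show thesis by (rule that)
qed

section \<open>Products of linear factors\<close>

primrec factor_prod :: "complex list \<Rightarrow> 'a \<Rightarrow> 'a" where
  "factor_prod [] x = x"
| "factor_prod (\<mu> # \<mu>s) x = factor_prod \<mu>s (T x - \<mu> *\<^sub>C x)"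

lemma hom_factor_prod: "module_hom scaleC scaleC (factor_prod \<mu>s)"
proof -
  have "factor_prod \<mu>s (x + y) = factor_prod \<mu>s x + factor_prod \<mu>s y" for x y
    by (induction \<mu>s arbitrary: x y) (simp_all add: T_add scaleC_add_right add_diff_add)
  moreover have "factor_prod \<mu>s (c *\<^sub>C x) = c *\<^sub>C factor_prod \<mu>s x" for c x
  proof (induction \<mu>s arbitrary: x)
    case (Cons \<mu> \<mu>s)
    have "T (c *\<^sub>C x) - \<mu> *\<^sub>C c *\<^sub>C x = c *\<^sub>C (T x - \<mu> *\<^sub>C x)"
      by (simp add: T_scale complex_vector.scale_right_diff_distrib scaleC_scaleC mult.commute)
    then show ?case using Cons by simp
  qed simp
  ultimately show ?thesis
    by (simp add: module_hom_def module_hom_axioms_def complex_vector.module_axioms)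
qed

lemmas factor_prod_diff = module_hom.diff[OF hom_factor_prod]
  and factor_prod_scale = module_hom.scale[OF hom_factor_prod]

lemma factor_prod_T: "factor_prod \<mu>s (T x) = T (factor_prod \<mu>s x)"
  by (induction \<mu>s arbitrary: x) (simp_all flip: T_scale T_diff)

lemma factor_prod_eigenvector:
  "T x = \<nu> *\<^sub>C x \<Longrightarrow> factor_prod \<mu>s x = (\<Prod>\<mu>\<leftarrow>\<mu>s. \<nu> - \<mu>) *\<^sub>C x"
proof (induction \<mu>s)
  case (Cons \<mu> \<mu>s)
  then have "factor_prod (\<mu> # \<mu>s) x = factor_prod \<mu>s ((\<nu> - \<mu>) *\<^sub>C x)"
    by (simp add: complex_vector.scale_left_diff_distrib)
  with Cons show ?case by (simp add: factor_prod_scale scaleC_scaleC)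
qed (simp add: scaleC_one)

lemma factor_prod_in_range:
  "\<mu> \<in> set \<mu>s \<Longrightarrow> \<exists>z. factor_prod \<mu>s x = T z - \<mu> *\<^sub>C z"
proof (induction \<mu>s arbitrary: x)
  case (Cons \<nu> \<mu>s)
  show ?case
  proof (cases "\<mu> = \<nu>")
    case True
    then show ?thesis
      by (auto simp: factor_prod_diff factor_prod_scale factor_prod_T)
  next
    case False
    then show ?thesis using Cons by simp
  qed
qed simp

text \<open>
  The product of the factors \<open>T - \<mu>\<close> for \<open>\<mu> \<in> F\<close> vanishes on the span of the eigenvectors for \<open>F\<close>, but not at
  an eigenvector for a further eigenvalue.
\<close>

lemma independent_eigenvectors:
  assumes "finite F" and eig: "\<And>\<mu>. \<mu> \<in> F \<Longrightarrow> e \<mu> \<noteq> 0 \<and> T (e \<mu>) = \<mu> *\<^sub>C e \<mu>"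
  shows "complex_vector.independent (e ` F)"
  using assms
proof (induction F rule: finite_induct)
  case empty
  then show ?case by (simp add: complex_vector.independent_empty)
next
  case (insert \<nu> F)
  obtain \<mu>s where \<mu>s: "set \<mu>s = F" using insert.hyps finite_list by blast
  have "complex_vector.span (e ` F) \<subseteq> {x. factor_prod \<mu>s x = 0}"
  proof (rule complex_vector.span_minimal)
    show "complex_vector.subspace {x. factor_prod \<mu>s x = 0}"
      by (rule module_hom.subspace_kernel[OF hom_factor_prod])
    show "e ` F \<subseteq> {x. factor_prod \<mu>s x = 0}"
    proof clarify
      fix \<mu> assume "\<mu> \<in> F"
      then have "factor_prod \<mu>s (e \<mu>) = (\<Prod>\<kappa>\<leftarrow>\<mu>s. \<mu> - \<kappa>) *\<^sub>C e \<mu>"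
        using insert.prems by (intro factor_prod_eigenvector) auto
      also have "(\<Prod>\<kappa>\<leftarrow>\<mu>s. \<mu> - \<kappa>) = 0"
        using \<open>\<mu> \<in> F\<close> \<mu>s by (auto simp: prod_list_zero_iff)
      finally show "factor_prod \<mu>s (e \<mu>) = 0" by simp
    qed
  qed
  moreover have "factor_prod \<mu>s (e \<nu>) \<noteq> 0"
  proof -
    have "factor_prod \<mu>s (e \<nu>) = (\<Prod>\<kappa>\<leftarrow>\<mu>s. \<nu> - \<kappa>) *\<^sub>C e \<nu>"
      using insert.prems by (intro factor_prod_eigenvector) auto
    moreover have "(\<Prod>\<kappa>\<leftarrow>\<mu>s. \<nu> - \<kappa>) \<noteq> 0"
      using insert.hyps \<mu>s by (auto simp: prod_list_zero_iff)
    ultimately show ?thesis using insert.prems by simp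
  qed
  ultimately have "e \<nu> \<notin> complex_vector.span (e ` F)" by blast
  then show ?case
    using insert by (simp add: complex_vector.independent_insertI)
qed

lemma finite_eigenvalues_in_span:
  assumes "finite B"
  shows "finite {\<mu>. \<exists>e \<in> complex_vector.span B. e \<noteq> 0 \<and> T e = \<mu> *\<^sub>C e}" (is "finite ?F")
proof (rule ccontr)
  assume "infinite ?F"
  then obtain F where F: "finite F" "card F = Suc (card B)" "F \<subseteq> ?F"
    using infinite_arbitrarily_large[of ?F "Suc (card B)"] by auto
  then have "\<forall>\<mu>\<in>F. \<exists>e. e \<in> complex_vector.span B \<and> e \<noteq> 0 \<and> T e = \<mu> *\<^sub>C e" by blast
  then obtain e where e: "\<And>\<mu>. \<mu> \<in> F \<Longrightarrow> e \<mu> \<in> complex_vector.span B"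
    and eig: "\<And>\<mu>. \<mu> \<in> F \<Longrightarrow> e \<mu> \<noteq> 0 \<and> T (e \<mu>) = \<mu> *\<^sub>C e \<mu>"
    by metis
  have "inj_on e F"
  proof (rule inj_onI)
    fix \<mu> \<nu> assume "\<mu> \<in> F" "\<nu> \<in> F" "e \<mu> = e \<nu>"
    with eig have "\<mu> *\<^sub>C e \<nu> = \<nu> *\<^sub>C e \<nu>" "e \<nu> \<noteq> 0" by metis+
    then show "\<mu> = \<nu>" by simp
  qed
  then have "card (e ` F) = Suc (card B)"
    using F by (simp add: card_image)
  moreover have "card (e ` F) \<le> card B"
    using complex_vector.independent_span_bound[OF assms independent_eigenvectors[OF F(1) eig]] e
    by blast
  ultimately show False by simp
qed

text \<open>
  Induction on the number of factors: the vectors \<open>T b - \<mu> b\<close> are annihilated by one factor fewer, and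
  \<open>T b\<close> lies in the span of \<open>b\<close> and \<open>T b - \<mu> b\<close>.
\<close>

lemma invariant_span_if_annihilated:
  assumes "finite B" and "\<And>b. b \<in> B \<Longrightarrow> factor_prod \<mu>s b = 0"
  shows "\<exists>B'. finite B' \<and> B \<subseteq> B' \<and> T ` B' \<subseteq> complex_vector.span B'"
  using assms
proof (induction \<mu>s arbitrary: B)
  case Nil
  have "T b \<in> complex_vector.span B" if "b \<in> B" for b
    using Nil.prems(2)[OF that] by (simp add: T_zero complex_vector.span_zero)
  with Nil show ?case by blast
next
  case (Cons \<mu> \<mu>s)
  let ?D = "(\<lambda>b. T b - \<mu> *\<^sub>C b) ` B"
  have "\<exists>B'. finite B' \<and> ?D \<subseteq> B' \<and> T ` B' \<subseteq> complex_vector.span B'"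
    using Cons.prems by (intro Cons.IH) auto
  then obtain B' where B': "finite B'" "?D \<subseteq> B'" "T ` B' \<subseteq> complex_vector.span B'"
    by blast
  have "T b \<in> complex_vector.span (B \<union> B')" if "b \<in> B" for b
  proof -
    have "(T b - \<mu> *\<^sub>C b) + \<mu> *\<^sub>C b \<in> complex_vector.span (B \<union> B')"
      using that B' by (intro complex_vector.span_add complex_vector.span_scale
          complex_vector.span_base) auto
    then show ?thesis by simp
  qed
  moreover have "T b \<in> complex_vector.span (B \<union> B')" if "b \<in> B'" for b
    using that B'(3) complex_vector.span_mono[of B' "B \<union> B'"] by blast
  ultimately have "T ` (B \<union> B') \<subseteq> complex_vector.span (B \<union> B')" by blast
  then show ?case
    using B' Cons.prems(1) by (intro exI[of _ "B \<union> B'"]) auto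
qed

section \<open>Ergodic sums\<close>

lemma hom_twisted_sum: "module_hom scaleC scaleC (twisted_sum \<omega> n)"
proof -
  have "twisted_sum \<omega> n (x + y) = twisted_sum \<omega> n x + twisted_sum \<omega> n y" for x y
    by (simp add: twisted_sum_def pow_add scaleC_add_right sum.distrib)
  moreover have "twisted_sum \<omega> n (c *\<^sub>C x) = c *\<^sub>C twisted_sum \<omega> n x" for c x
    by (simp add: twisted_sum_def pow_scale complex_vector.scale_sum_right scaleC_scaleC mult.commute)
  ultimately show ?thesis
    by (simp add: module_hom_def module_hom_axioms_def complex_vector.module_axioms)
qed

lemma twisted_sum_T: "twisted_sum \<omega> n (T x) = T (twisted_sum \<omega> n x)"
  by (simp add: twisted_sum_def T_sum T_scale funpow_swap1)

lemma twisted_sum_bound: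
  assumes "cmod \<omega> = 1"
  shows "norm (twisted_sum \<omega> n x) \<le> real n * C * norm x"
proof -
  have "norm (twisted_sum \<omega> n x) \<le> (\<Sum>k<n. C * norm x)"
    unfolding twisted_sum_def using assms upper
    by (intro sum_norm_le) (auto simp: norm_scaleC norm_power)
  then show ?thesis by simp
qed

lemma twisted_sum_eigenvector:
  assumes "T x = \<mu> *\<^sub>C x" "\<mu> \<noteq> 0"
  shows "twisted_sum (inverse \<mu>) n x = of_nat n *\<^sub>C x"
proof -
  have "(T ^^ k) x = \<mu> ^ k *\<^sub>C x" for k
    by (induction k) (simp_all add: scaleC_one assms T_scale scaleC_scaleC mult.commute)
  then have "(inverse \<mu>) ^ k *\<^sub>C (T ^^ k) x = x" for k
    using assms by (simp add: scaleC_scaleC scaleC_one flip: power_mult_distrib)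
  then show ?thesis
    by (simp add: twisted_sum_def complex_vector.sum_constant_scale)
qed

text \<open>
  The sums telescope, so they stay bounded on the range of \<open>T - \<mu>\<close>, whereas by
  \<open>twisted_sum_eigenvector\<close> they grow linearly at an eigenvector for \<open>\<mu>\<close>. This is what tells the two
  apart.
\<close>

lemma twisted_sum_bounded_on_range:
  assumes "cmod \<mu> = 1"
  shows "norm (twisted_sum (inverse \<mu>) n (T z - \<mu> *\<^sub>C z)) \<le> (1 + C) * norm z"
proof -
  have "twisted_sum (inverse \<mu>) n (T z - \<mu> *\<^sub>C z)
      = T (twisted_sum (inverse \<mu>) n z) - inverse (inverse \<mu>) *\<^sub>C twisted_sum (inverse \<mu>) n z"
    by (simp add: module_hom.diff[OF hom_twisted_sum] module_hom.scale[OF hom_twisted_sum]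
        twisted_sum_T)
  then show ?thesis
    using twisted_sum_telescope_norm[of "inverse \<mu>" n z] assms by (simp add: norm_inverse)
qed

section \<open>Transfer of approximate eigenvectors to the generating subspace\<close>

text \<open>
  An approximate eigenvector \<open>u\<close> in the range of the product is replaced by a vector of the span. The
  operators compared are the identity, \<open>T - \<nu>\<close> and the ergodic sums for the unimodular \<open>\<mu>\<close> in the list; the last
  clause records that \<open>u\<close> lies in the range of each \<open>T - \<mu>\<close>.
\<close>

lemma transferred_approximate_eigenvector:
  assumes B: "finite B" and dense: "closure (\<Union>n. (T ^^ n) ` complex_vector.span B) = UNIV"
    and z: "factor_prod \<mu>s z \<noteq> 0" and "\<epsilon> > 0"
  obtains \<nu> v where "cmod \<nu> = 1" "v \<in> complex_vector.span B" "norm v = 1"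
    "norm (T v - \<nu> *\<^sub>C v) \<le> \<epsilon>"
    "\<And>\<mu>. \<mu> \<in> set \<mu>s \<Longrightarrow> cmod \<mu> = 1 \<Longrightarrow> \<exists>K. \<forall>n. norm (twisted_sum (inverse \<mu>) n v) \<le> K"
proof -
  let ?Y = "range (factor_prod \<mu>s)"
  have "complex_vector.subspace ?Y"
    by (intro module_hom.subspace_image[OF hom_factor_prod] complex_vector.subspace_UNIV)
  moreover have "T ` ?Y \<subseteq> ?Y"
    by (auto simp flip: factor_prod_T)
  \<comment> \<open>One factor \<open>C\<close> is lost in comparing \<open>T e - \<nu> e\<close> with \<open>T u - \<nu> u\<close>, another in comparing \<open>u\<close> with \<open>e\<close>.\<close>
  moreover have "\<epsilon> / C\<^sup>2 > 0" using \<open>\<epsilon> > 0\<close> C_pos by simp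
  ultimately obtain \<nu> u where \<nu>: "cmod \<nu> = 1" and u: "u \<in> ?Y" "u \<noteq> 0"
    and approx: "norm (T u - \<nu> *\<^sub>C u) \<le> \<epsilon> / C\<^sup>2 * norm u"
    using approximate_eigenvector z by (metis rangeI)
  obtain e where e: "e \<in> complex_vector.span B" and ue: "u \<in> closure (range (\<lambda>n. (T ^^ n) e))"
    using dense_orbits_reach_every_vector[OF B dense] by blast
  have norm_ue: "norm u \<le> C * norm e"
    using commuting_norms_comparable(2)[OF hom_pow[of 0] _ _ ue, of 1] by simp
  then have "e \<noteq> 0" using \<open>u \<noteq> 0\<close> by auto
  have "factor_prod [\<nu>] = (\<lambda>x. T x - \<nu> *\<^sub>C x)"
    by (rule ext) simp
  then have hom_d: "module_hom scaleC scaleC (\<lambda>x. T x - \<nu> *\<^sub>C x)"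
    using hom_factor_prod[of "[\<nu>]"] by metis
  have "norm (T e - \<nu> *\<^sub>C e) \<le> C * norm (T u - \<nu> *\<^sub>C u)"
  proof (rule commuting_norms_comparable(1)[OF hom_d _ _ ue])
    show "norm (T x - \<nu> *\<^sub>C x) \<le> (C + 1) * norm x" for x
      using upper[of 1 x] norm_triangle_ineq4[of "T x" "\<nu> *\<^sub>C x"] \<nu>
      by (simp add: norm_scaleC distrib_right)
    show "T (T x) - \<nu> *\<^sub>C T x = T (T x - \<nu> *\<^sub>C x)" for x
      by (simp add: T_diff T_scale)
  qed
  also have "\<dots> \<le> C * (\<epsilon> / C\<^sup>2 * (C * norm e))"
    using approx norm_ue C_pos \<open>\<epsilon> > 0\<close>
    by (intro mult_left_mono order_trans[OF approx]) auto
  also have "\<dots> = \<epsilon> * norm e"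
    using C_pos by (simp add: power2_eq_square)
  finally have e_approx: "norm (T e - \<nu> *\<^sub>C e) \<le> \<epsilon> * norm e" .
  define c where "c = complex_of_real (inverse (norm e))"
  have c: "cmod c = inverse (norm e)" by (simp add: c_def norm_inverse)
  show thesis
  proof (rule that[OF \<nu>])
    show "c *\<^sub>C e \<in> complex_vector.span B"
      using e by (rule complex_vector.span_scale)
    show "norm (c *\<^sub>C e) = 1"
      using \<open>e \<noteq> 0\<close> c by (simp add: norm_scaleC)
    have "T (c *\<^sub>C e) - \<nu> *\<^sub>C c *\<^sub>C e = c *\<^sub>C (T e - \<nu> *\<^sub>C e)"
      by (rule module_hom.scale[OF hom_d])
    then have "norm (T (c *\<^sub>C e) - \<nu> *\<^sub>C c *\<^sub>C e) = inverse (norm e) * norm (T e - \<nu> *\<^sub>C e)"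
      by (simp only: norm_scaleC c)
    also have "\<dots> \<le> inverse (norm e) * (\<epsilon> * norm e)"
      using e_approx by (intro mult_left_mono) auto
    also have "\<dots> = \<epsilon>" using \<open>e \<noteq> 0\<close> by simp
    finally show "norm (T (c *\<^sub>C e) - \<nu> *\<^sub>C c *\<^sub>C e) \<le> \<epsilon>" .
    fix \<mu> assume \<mu>: "\<mu> \<in> set \<mu>s" "cmod \<mu> = 1"
    then obtain x where x: "u = T x - \<mu> *\<^sub>C x"
      using u factor_prod_in_range by blast
    have "norm (twisted_sum (inverse \<mu>) n (c *\<^sub>C e)) \<le> cmod c * (C * ((1 + C) * norm x))" for n
    proof -
      have "cmod (inverse \<mu>) = 1" using \<mu>(2) by (simp add: norm_inverse)
      then have "norm (twisted_sum (inverse \<mu>) n e) \<le> C * norm (twisted_sum (inverse \<mu>) n u)"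
        by (rule commuting_norms_comparable(1)[OF hom_twisted_sum twisted_sum_bound twisted_sum_T ue])
      also have "\<dots> \<le> C * ((1 + C) * norm x)"
        unfolding x using C_pos twisted_sum_bounded_on_range[OF \<mu>(2)]
        by (intro mult_left_mono) auto
      finally show ?thesis
        by (simp add: module_hom.scale[OF hom_twisted_sum] norm_scaleC mult_left_mono)
    qed
    then show "\<exists>K. \<forall>n. norm (twisted_sum (inverse \<mu>) n (c *\<^sub>C e)) \<le> K" by blast
  qed
qed

text \<open>
  Otherwise the approximate eigenvectors in the span, normalized, accumulate at an eigenvector \<open>w\<close>, and its
  eigenvalue \<open>\<mu>\<close> is in the list. The ergodic sums for \<open>\<mu>\<close> grow like \<open>n\<close> at \<open>w\<close> but stay bounded at each
  of the approximating vectors. This is impossible, since the averages are Lipschitz with the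
  constant \<open>C\<close>, which is the same for every \<open>n\<close>.
\<close>

lemma factor_prod_annihilates:
  assumes B: "finite B" and dense: "closure (\<Union>n. (T ^^ n) ` complex_vector.span B) = UNIV"
    and \<mu>s: "\<And>\<mu> e. cmod \<mu> = 1 \<Longrightarrow> e \<in> complex_vector.span B \<Longrightarrow> e \<noteq> 0 \<Longrightarrow> T e = \<mu> *\<^sub>C e
      \<Longrightarrow> \<mu> \<in> set \<mu>s"
  shows "factor_prod \<mu>s z = 0"
proof (rule ccontr)
  assume z: "factor_prod \<mu>s z \<noteq> 0"
  let ?E = "complex_vector.span B"
  define bdd where "bdd v \<longleftrightarrow> (\<forall>\<mu>\<in>set \<mu>s. cmod \<mu> = 1 \<longrightarrow>
      (\<exists>K. \<forall>n. norm (twisted_sum (inverse \<mu>) n v) \<le> K))" for v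
  have "\<exists>\<nu> v. cmod \<nu> = 1 \<and> v \<in> ?E \<and> norm v = 1
      \<and> norm (T v - \<nu> *\<^sub>C v) \<le> inverse (real (Suc k)) \<and> bdd v" for k
    by (rule transferred_approximate_eigenvector[OF B dense z, of "inverse (real (Suc k))"])
      (auto simp: bdd_def)
  then obtain \<nu> v where \<nu>: "\<And>k. cmod (\<nu> k) = 1" and v: "\<And>k. v k \<in> ?E" "\<And>k. norm (v k) = 1"
    and approx: "\<And>k. norm (T (v k) - \<nu> k *\<^sub>C v k) \<le> inverse (real (Suc k))"
    and bdd: "\<And>k. bdd (v k)"
    by metis
  have in_compact: "(v k, \<nu> k) \<in> (?E \<inter> cball 0 1) \<times> sphere 0 1" for k
    using \<nu> v by simp
  have "compact ((?E \<inter> cball 0 1) \<times> sphere (0::complex) 1)"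
    using compact_span_Int_cball[OF B] by (simp add: compact_Times)
  then have "seq_compact ((?E \<inter> cball 0 1) \<times> sphere (0::complex) 1)"
    by (rule compact_imp_seq_compact)
  then obtain p r where p: "p \<in> (?E \<inter> cball 0 1) \<times> sphere 0 1" and r: "strict_mono r"
    and lim: "((\<lambda>k. (v k, \<nu> k)) \<circ> r) \<longlonglongrightarrow> p"
    by (rule seq_compactE[where f = "\<lambda>k. (v k, \<nu> k)"]) (use in_compact in auto)
  obtain w \<mu> where pw: "p = (w, \<mu>)" by (cases p)
  have vw: "(\<lambda>k. v (r k)) \<longlonglongrightarrow> w" and \<nu>\<mu>: "(\<lambda>k. \<nu> (r k)) \<longlonglongrightarrow> \<mu>"
    using tendsto_fst[OF lim] tendsto_snd[OF lim] by (simp_all add: pw o_def)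
  from p pw have w: "w \<in> ?E" and \<mu>: "cmod \<mu> = 1" by auto
  have "norm w = 1"
    using tendsto_norm[OF vw] v(2) by (simp add: LIMSEQ_const_iff)
  have diff0: "(\<lambda>k. norm (v (r k) - w)) \<longlonglongrightarrow> 0"
    using vw by (simp add: LIM_zero tendsto_norm_zero)
  have "(\<lambda>k. T (v (r k)) - T w) \<longlonglongrightarrow> 0"
  proof (rule Lim_null_comparison)
    show "\<forall>\<^sub>F k in sequentially. norm (T (v (r k)) - T w) \<le> C * norm (v (r k) - w)"
      using upper[of 1] by (simp flip: T_diff)
    show "(\<lambda>k. C * norm (v (r k) - w)) \<longlonglongrightarrow> 0"
      using tendsto_mult_right_zero[OF diff0] by simp
  qed
  then have "(\<lambda>k. T (v (r k))) \<longlonglongrightarrow> T w" by (simp add: LIM_zero_iff)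
  then have "(\<lambda>k. T (v (r k)) - \<nu> (r k) *\<^sub>C v (r k)) \<longlonglongrightarrow> T w - \<mu> *\<^sub>C w"
    by (intro tendsto_diff tendsto_scaleC vw \<nu>\<mu>)
  moreover have "(\<lambda>k. T (v (r k)) - \<nu> (r k) *\<^sub>C v (r k)) \<longlonglongrightarrow> 0"
  proof (rule Lim_null_comparison)
    show "\<forall>\<^sub>F k in sequentially. norm (T (v (r k)) - \<nu> (r k) *\<^sub>C v (r k)) \<le> inverse (real (Suc (r k)))"
      using approx by simp
    show "(\<lambda>k. inverse (real (Suc (r k)))) \<longlonglongrightarrow> 0"
      using LIMSEQ_subseq_LIMSEQ[OF LIMSEQ_inverse_real_of_nat r] by (simp add: o_def)
  qed
  ultimately have eig: "T w = \<mu> *\<^sub>C w"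
    using LIMSEQ_unique by fastforce
  then have "\<mu> \<in> set \<mu>s"
    using \<mu>s[OF \<mu> w] \<open>norm w = 1\<close> by (metis norm_zero zero_neq_one)
  \<comment> \<open>At this distance the ergodic average of \<open>v (r k)\<close> differs from that of \<open>w\<close> by at most one half.\<close>
  have "\<forall>\<^sub>F k in sequentially. norm (v (r k) - w) < inverse (2 * C)"
    by (rule order_tendstoD(2)[OF diff0]) (use C_pos in simp)
  then obtain k where k: "norm (v (r k) - w) < inverse (2 * C)"
    by (auto simp: eventually_sequentially)
  obtain K where K: "\<And>n. norm (twisted_sum (inverse \<mu>) n (v (r k))) \<le> K"
    using bdd[of "r k"] \<open>\<mu> \<in> set \<mu>s\<close> \<mu> unfolding bdd_def by blast
  have "real n \<le> 2 * K" for n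
  proof -
    let ?A = "twisted_sum (inverse \<mu>) n"
    have "\<mu> \<noteq> 0" using \<mu> by auto
    then have "real n = norm (?A w)"
      using twisted_sum_eigenvector[OF eig] \<open>norm w = 1\<close> by (simp add: norm_scaleC)
    also have "\<dots> \<le> norm (?A (v (r k))) + norm (?A (v (r k) - w))"
      unfolding module_hom.diff[OF hom_twisted_sum]
      by (metis norm_minus_commute norm_triangle_sub)
    also have "\<dots> \<le> K + real n * C * norm (v (r k) - w)"
      using K[of n] twisted_sum_bound[of "inverse \<mu>" n "v (r k) - w"] \<mu> by (simp add: norm_inverse)
    also have "\<dots> \<le> K + real n * C * inverse (2 * C)"
      using k C_pos by (intro add_left_mono mult_left_mono) auto
    also have "\<dots> = K + real n / 2"
      using C_pos by (simp add: field_simps)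
    finally show ?thesis by simp
  qed
  then show False
    by (meson not_less reals_Archimedean2)
qed

section \<open>Finite dimension of the space\<close>

theorem finite_dimensional_if_dense_orbits:
  assumes B: "finite B" and dense: "closure (\<Union>n. (T ^^ n) ` complex_vector.span B) = UNIV"
  shows "cfinite_dim (UNIV :: 'a set)"
proof -
  obtain \<mu>s where \<mu>s:
    "set \<mu>s = {\<mu>. \<exists>e \<in> complex_vector.span B. e \<noteq> 0 \<and> T e = \<mu> *\<^sub>C e}"
    using finite_list[OF finite_eigenvalues_in_span[OF B]] by (elim exE)
  have "factor_prod \<mu>s z = 0" for z
    by (rule factor_prod_annihilates[OF B dense]) (auto simp: \<mu>s)
  then have "\<exists>B'. finite B' \<and> B \<subseteq> B' \<and> T ` B' \<subseteq> complex_vector.span B'"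
    using invariant_span_if_annihilated[OF B] by metis
  then obtain B' where B': "finite B'" "B \<subseteq> B'" "T ` B' \<subseteq> complex_vector.span B'"
    by (elim exE conjE)
  let ?S = "complex_vector.span B'"
  have "?S \<subseteq> {x. T x \<in> ?S}"
    using B' by (intro complex_vector.span_minimal
        module_hom.subspace_vimage[OF hom, unfolded vimage_def] complex_vector.subspace_span) auto
  then have "(T ^^ n) x \<in> ?S" if "x \<in> ?S" for n x
    using that by (induction n) auto
  then have "(\<Union>n. (T ^^ n) ` complex_vector.span B) \<subseteq> ?S"
    using complex_vector.span_mono[OF B'(2)] by blast
  then have "closure (\<Union>n. (T ^^ n) ` complex_vector.span B) \<subseteq> ?S"
    using closed_span_finite[OF B'(1)] by (rule closure_minimal)
  then show ?thesis
    using dense B'(1) unfolding cfinite_dim_def by blast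
qed

end

theorem proposition6p8:
  fixes T :: "'a::complex_banach \<Rightarrow> 'a" and m :: nat
  assumes "\<not> cfinite_dim (UNIV :: 'a set)"
    and "m \<ge> 1"
    and "bounded_clinear T"
    and "m_infty_isometry m T"
  shows "\<forall>N::nat. N \<ge> 1 \<longrightarrow> \<not> N_supercyclic N T"
proof (intro allI impI notI)
  fix N assume "N_supercyclic N T"
  then obtain B where "finite B" "closure (\<Union>n. (T ^^ n) ` complex_vector.span B) = UNIV"
    unfolding N_supercyclic_def cfinite_dim_def by blast
  moreover obtain C where "two_sided_power_bounded T C"
    using m_infty_isometry_two_sided_power_bounded assms by blast
  ultimately have "cfinite_dim (UNIV :: 'a set)"
    using two_sided_power_bounded.finite_dimensional_if_dense_orbits by blast
  with assms(1) show False ..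
qed

end
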